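(* Let $D$ be the block matrix described in the context, and for $0\leq k\leq 2n-1$ let $\bar D_{k}$ be the $l\times l$ matrix defined there. Then the characteristic polynomial of $D$ is \begin{align*} \chi_{D}(t)=\left(\prod_{k\ \text{even}}\chi_{\bar D_{k}}(t)\right)\left(\prod_{k\ \text{odd}}\frac{1}{t}\chi_{\bar D_{k}}(t)\right)=\frac{1}{t^{n}}\prod_{k=0}^{2n-1}\chi_{\bar D_{k}}(t), \end{align*} where $\chi_{X}(t)=\det(tI-X)$ and the products run over $0\leq k\leq 2n-1$.
   Context: Let $l,n$ be positive integers. A square matrix of size $p$ is called cyclic (circulant) if its $(r,s)$ entry depends only on $s-r \bmod p$. For a matrix $X$, $X^{(1)}$ denotes its first row. Let $\zeta_{p}$ be a primitive $p$th root of unity and $\mathbf{z}_{p,k}=(1,\zeta_{p}^{k},\zeta_{p}^{2k},\ldots,\zeta_{p}^{(p-1)k})^{T}$. Let $D=(D^{ij})_{1\leq i,j\leq l}$ be a block matrix where $D^{ij}$ is a $2n\times 2n$ cyclic matrix for $1\leq i,j\leq l-1$, $D^{ll}$ is an $n\times n$ cyclic matrix, and for $1\leq i,j\leq l-1$, $D^{il}=\begin{pmatrix}X_{i}\\ X_{i}\end{pmatrix}$, $D^{lj}=\begin{pmatrix}Y_{j}&Y_{j}\end{pmatrix}$ with $X_{i},Y_{j}$ $n\times n$ cyclic matrices. For $0\leq k\leq 2n-1$ define the $l\times l$ matrix $\bar D_{k}=(d^{(k)}_{ij})_{1\leq i,j\leq l}$: if $k$ is even, $d^{(k)}_{ij}=(D^{ij})^{(1)}\mathbf{z}_{2n,k}$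 for $1\leq j\leq l-1$ and $d^{(k)}_{il}=(D^{il})^{(1)}\mathbf{z}_{n,k/2}$; if $k$ is odd, $d^{(k)}_{ij}=(D^{ij})^{(1)}\mathbf{z}_{2n,k}$ for $1\leq j\leq l-1$ and $d^{(k)}_{il}=0$.
   Formalization: The primitive roots are assumed compatible, ζ_n = ζ_{2n}^2 (as for ζ_p = exp(2πi/p)); for incompatible choices, e.g. n = 3, l = 2, ζ_3 = ζ_6^{-2}, the identity fails. Matrix entries are complex. *)

theory Defs
  imports
    "Jordan_Normal_Form.Char_Poly"
    "HOL-Computational_Algebra.Polynomial_Factorial"
    Complex_Main
begin

definition cyclic_mat :: "nat \<Rightarrow> 'a mat \<Rightarrow> bool" where
  "cyclic_mat p A \<longleftrightarrow> A \<in> carrier_mat p p \<and>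
     (\<forall>r<p. \<forall>s<p. \<forall>r'<p. \<forall>s'<p.
        (int s - int r) mod int p = (int s' - int r') mod int p
          \<longrightarrow> A $$ (r, s) = A $$ (r', s'))"

definition append_cols :: "'a :: zero mat \<Rightarrow> 'a mat \<Rightarrow> 'a mat" where
  "append_cols A B = four_block_mat A B (0\<^sub>m 0 (dim_col A)) (0\<^sub>m 0 (dim_col B))"

definition primitive_root_of_unity :: "nat \<Rightarrow> complex \<Rightarrow> bool" where
  "primitive_root_of_unity p w \<longleftrightarrow> p > 0 \<and> w ^ p = 1 \<and> (\<forall>m. 0 < m \<and> m < p \<longrightarrow> w ^ m \<noteq> 1)"

definition z_vec :: "(nat \<Rightarrow> complex) \<Rightarrow> nat \<Rightarrow> nat \<Rightarrow> complex vec" where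
  "z_vec \<zeta> p k = vec p (\<lambda>m. \<zeta> p ^ (m * k))"

text \<open>Block indices are 0-based: the paper's block \<open>(i, j)\<close> is \<open>B (i - 1) (j - 1)\<close>, and the
  index \<open>l - 1\<close> denotes the last block row or column, of size \<open>n\<close>; the others have size \<open>2 * n\<close>.
  As only the last block is shorter, quotient and remainder by \<open>2 * n\<close> give the block
  containing an index and the position inside that block.\<close>

definition assemble :: "nat \<Rightarrow> nat \<Rightarrow> (nat \<Rightarrow> nat \<Rightarrow> complex mat) \<Rightarrow> complex mat" where
  "assemble l n B = mat ((l - 1) * (2 * n) + n) ((l - 1) * (2 * n) + n)
     (\<lambda>(r, s). B (r div (2 * n)) (s div (2 * n)) $$ (r mod (2 * n), s mod (2 * n)))"

definition D_bar ::
  "(nat \<Rightarrow> complex) \<Rightarrow> nat \<Rightarrow> nat \<Rightarrow> (nat \<Rightarrow> nat \<Rightarrow> complex mat) \<Rightarrow> nat \<Rightarrow> complex mat" where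
  "D_bar \<zeta> l n B k = mat l l (\<lambda>(i, j).
     if j < l - 1 then row (B i j) 0 \<bullet> z_vec \<zeta> (2 * n) k
     else if even k then row (B i j) 0 \<bullet> z_vec \<zeta> n (k div 2)
     else 0)"

lemma assemble_block_index:
  fixes l n :: nat and B :: "nat \<Rightarrow> nat \<Rightarrow> complex mat"
  assumes "i < l" "j < l"
    and r: "r < (if i = l - 1 then n else 2 * n)"
    and s: "s < (if j = l - 1 then n else 2 * n)"
  shows "assemble l n B $$ (i * (2 * n) + r, j * (2 * n) + s) = B i j $$ (r, s)"
proof -
  have bound: "i' * (2 * n) + r' < (l - 1) * (2 * n) + n"
    if "i' < l" "r' < (if i' = l - 1 then n else 2 * n)" for i' r'
  proof (cases "i' = l - 1")
    case False
    then have "Suc i' * (2 * n) \<le> (l - 1) * (2 * n)" using that by (intro mult_le_mono1) auto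
    then show ?thesis using that False by simp
  qed (use that in simp)
  have "r < 2 * n" "s < 2 * n" using r s by (auto split: if_splits)
  then show ?thesis
    using bound[OF assms(1) r] bound[OF assms(2) s]
    by (simp add: assemble_def)
qed

end

theory Submission
  imports Defs
begin

text \<open>
  Let \<open>\<omega> = \<zeta> (2 * n)\<close>. A cyclic matrix of size \<open>p\<close> has \<open>(w ^ b)\<^sub>b\<close> as an eigenvector whenever
  \<open>w ^ p = 1\<close>, with its first row giving the eigenvalue. Since \<open>\<omega> ^ n = - 1\<close>, the two copies in
  \<open>(Y Y)\<close> cancel against \<open>z\<close> for odd \<open>k\<close>, and for even \<open>k\<close> the vector \<open>z\<close> of length \<open>2 * n\<close> is two
  copies of the one of length \<open>n\<close>. So for each \<open>k\<close> the vectors \<open>e\<^sub>j \<otimes> z\<close> span a \<open>D\<close>-invariant space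
  on which \<open>D\<close> acts as \<open>D_bar k\<close>, except that the last coordinate is missing for odd \<open>k\<close>.
  Padding \<open>D\<close> with \<open>n\<close> zero rows and columns, whose unit vectors serve as the last coordinate for
  the \<open>n\<close> odd values of \<open>k\<close>, makes all blocks equally large: the padded matrix is similar to the
  block diagonal matrix of all \<open>D_bar k\<close>, and its characteristic polynomial is \<open>t ^ n\<close> times that
  of \<open>D\<close>.
\<close>

section \<open>Rearranging finite sums over block indices\<close>

text \<open>Flat matrix indices are decoded by \<open>div\<close> and \<open>mod\<close>. This turns
  the sums in matrix products into double sums over block and position.\<close>

lemma sum_div_mod:
  fixes f :: "nat \<Rightarrow> nat \<Rightarrow> 'a :: comm_monoid_add"
  shows "(\<Sum>r<l * p. f (r div p) (r mod p)) = (\<Sum>i<l. \<Sum>a<p. f i a)"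
proof -
  have "(\<Sum>r<l * p. f (r div p) (r mod p))
      = (\<Sum>i<l. \<Sum>r = i * p..<i * p + p. f (r div p) (r mod p))"
    by (rule sum.nat_group [symmetric])
  also have "\<dots> = (\<Sum>i<l. \<Sum>a<p. f i a)"
  proof (rule sum.cong [OF refl])
    fix i
    have "(\<Sum>r = i * p..<i * p + p. f (r div p) (r mod p))
        = (\<Sum>a = 0..<p. f ((a + i * p) div p) ((a + i * p) mod p))"
      using sum.shift_bounds_nat_ivl [of "\<lambda>r. f (r div p) (r mod p)" 0 "i * p" p]
      by (simp add: add.commute)
    also have "\<dots> = (\<Sum>a<p. f i a)"
      by (auto simp: lessThan_atLeast0 intro!: sum.cong)
    finally show "(\<Sum>r = i * p..<i * p + p. f (r div p) (r mod p)) = (\<Sum>a<p. f i a)" .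
  qed
  finally show ?thesis .
qed

lemma sum_even_odd:
  fixes f :: "nat \<Rightarrow> 'a :: comm_monoid_add"
  shows "(\<Sum>k<2 * n. f k) = (\<Sum>m<n. f (2 * m)) + (\<Sum>m<n. f (Suc (2 * m)))"
  by (induction n) (simp_all add: ac_simps)

lemma sum_double:
  fixes f :: "nat \<Rightarrow> 'a :: comm_monoid_add"
  shows "(\<Sum>k<2 * n. f k) = (\<Sum>m<n. f m) + (\<Sum>m<n. f (n + m))"
  using sum.nat_group [of f n 2] sum.shift_bounds_nat_ivl [of f 0 n n]
  by (simp add: numeral_2_eq_2 lessThan_atLeast0 add.commute)

section \<open>Characteristic polynomials of block diagonal matrices and of matrices similar to
  them\<close>

lemma char_poly_four_block_mat_diag:
  fixes A D :: "'a :: idom mat"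
  assumes A: "A \<in> carrier_mat n n" and D: "D \<in> carrier_mat m m"
  shows "char_poly (four_block_mat A (0\<^sub>m n m) (0\<^sub>m m n) D) = char_poly A * char_poly D"
proof -
  have "char_poly_matrix (four_block_mat A (0\<^sub>m n m) (0\<^sub>m m n) D)
      = four_block_mat (char_poly_matrix A) (0\<^sub>m n m) (0\<^sub>m m n) (char_poly_matrix D)"
    using A D by (intro eq_matI) (auto simp: char_poly_matrix_def)
  then show ?thesis
    using A D by (simp add: char_poly_def det_four_block_mat_lower_left_zero [of _ n _ m])
qed

lemma char_poly_zero_mat: "char_poly (0\<^sub>m n n :: 'a :: idom mat) = [:0, 1:] ^ n"
proof -
  have "upper_triangular (0\<^sub>m n n :: 'a mat)"
    by auto
  then have "char_poly (0\<^sub>m n n :: 'a mat) = (\<Prod>a \<leftarrow> diag_mat (0\<^sub>m n n :: 'a mat). [:- a, 1:])"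
    by (rule char_poly_upper_triangular [OF zero_carrier_mat])
  also have "diag_mat (0\<^sub>m n n :: 'a mat) = replicate n 0"
    by (auto simp: diag_mat_def intro!: nth_equalityI)
  finally show ?thesis
    by simp
qed

text \<open>Induction on the number of blocks: the last diagonal block, \<open>F p\<close>, is split
  off as the lower right corner of a four-block matrix.\<close>

lemma char_poly_block_diag:
  fixes F :: "nat \<Rightarrow> nat \<Rightarrow> nat \<Rightarrow> 'a :: idom"
  assumes l: "l > 0"
  shows "char_poly (mat (p * l) (p * l)
           (\<lambda>(r, s). if r div l = s div l then F (r div l) (r mod l) (s mod l) else 0))
       = (\<Prod>k<p. char_poly (mat l l (\<lambda>(i, j). F k i j)))"
proof (induction p)
  case 0
  then show ?case
    by (simp add: char_poly_def)
next
  case (Suc p)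
  let ?E = "\<lambda>(r, s). if r div l = s div l then F (r div l) (r mod l) (s mod l) else 0"
  have lt: "r div l < p" if "r < p * l" for r
    using that by (simp add: less_mult_imp_div_less)
  have ge: "r div l = p" "r mod l = r - p * l" if "\<not> r < p * l" "r < l + p * l" for r
  proof -
    define a where "a = r - p * l"
    have r: "r = a + p * l" and a: "a < l"
      using that by (simp_all add: a_def)
    show "r div l = p" "r mod l = r - p * l"
      using a by (simp_all add: r)
  qed
  have "mat (Suc p * l) (Suc p * l) ?E = four_block_mat (mat (p * l) (p * l) ?E)
      (0\<^sub>m (p * l) l) (0\<^sub>m l (p * l)) (mat l l (\<lambda>(i, j). F p i j))"
  proof (rule eq_matI, goal_cases)
    case (1 r s)
    then show ?case
      using lt[of r] lt[of s] ge[of r] ge[of s]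
      by (cases "r < p * l"; cases "s < p * l") (auto simp: add.commute)
  qed (simp_all add: add.commute)
  then show ?case
    by (simp add: char_poly_four_block_mat_diag [of _ "p * l" _ l] Suc.IH)
qed

text \<open>By \<open>eig\<close>, for each \<open>k\<close> the span over \<open>j\<close> of the vectors \<open>e\<^sub>j \<otimes> g j _ k\<close> is invariant, and
  the matrix acts on it as \<open>d k\<close>.\<close>

lemma char_poly_block_diagonalised:
  fixes g h d :: "nat \<Rightarrow> nat \<Rightarrow> nat \<Rightarrow> 'a :: field" and C :: "nat \<Rightarrow> nat \<Rightarrow> nat \<Rightarrow> nat \<Rightarrow> 'a"
  assumes l: "l > 0" and p: "p > 0"
    and eig: "\<And>i j a k. i < l \<Longrightarrow> j < l \<Longrightarrow> a < p \<Longrightarrow> k < p \<Longrightarrow>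
      (\<Sum>b<p. C i j a b * g j b k) = g i a k * d k i j"
    and inv: "\<And>i a b. i < l \<Longrightarrow> a < p \<Longrightarrow> b < p \<Longrightarrow>
      (\<Sum>k<p. g i a k * h i k b) = (if a = b then 1 else 0)"
  shows "char_poly (mat (l * p) (l * p) (\<lambda>(r, s). C (r div p) (s div p) (r mod p) (s mod p)))
       = (\<Prod>k<p. char_poly (mat l l (\<lambda>(i, j). d k i j)))"
proof -
  define N where "N = l * p"
  define A where "A = mat N N (\<lambda>(r, s). C (r div p) (s div p) (r mod p) (s mod p))"
  \<comment> \<open>Two orders of index pairs meet here. Rows of \<open>G\<close> are numbered as in
    \<open>A\<close>, by block \<open>i\<close> and position \<open>a\<close> as
    \<open>i * p + a\<close>; columns as in \<open>M\<close>, by \<open>k\<close> and block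
    \<open>j\<close> as \<open>k * l + j\<close>. Column \<open>k * l + j\<close> is the vector that
    carries \<open>g j _ k\<close> in block \<open>j\<close> and is zero elsewhere.\<close>
  define G where "G = mat N N (\<lambda>(r, c). if r div p = c mod l then g (r div p) (r mod p) (c div l) else 0)"
  define H where "H = mat N N (\<lambda>(c, r). if r div p = c mod l then h (r div p) (c div l) (r mod p) else 0)"
  define M where "M = mat N N (\<lambda>(c, e). if c div l = e div l then d (c div l) (c mod l) (e mod l) else 0)"
  have carr: "A \<in> carrier_mat N N" "G \<in> carrier_mat N N" "H \<in> carrier_mat N N" "M \<in> carrier_mat N N"
    by (simp_all add: A_def G_def H_def M_def)
  have bounds: "r div p < l" "r mod p < p" "r div l < p" "r mod l < l" if "r < N" for r
    using that l p by (simp_all add: N_def less_mult_imp_div_less mult.commute)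
  have sum_lp: "(\<Sum>r<N. f (r div p) (r mod p)) = (\<Sum>i<l. \<Sum>a<p. f i a)" for f :: "nat \<Rightarrow> nat \<Rightarrow> 'a"
    by (simp add: N_def sum_div_mod)
  have sum_pl: "(\<Sum>c<N. f (c div l) (c mod l)) = (\<Sum>k<p. \<Sum>j<l. f k j)" for f :: "nat \<Rightarrow> nat \<Rightarrow> 'a"
    by (simp add: N_def mult.commute[of l p] sum_div_mod)
  have "A * G = G * M"
  proof (rule eq_matI)
    fix r c assume "r < dim_row (G * M)" "c < dim_col (G * M)"
    then have rc: "r < N" "c < N"
      using carr by auto
    have "(A * G) $$ (r, c) = (\<Sum>s<N. C (r div p) (s div p) (r mod p) (s mod p)
        * (if s div p = c mod l then g (s div p) (s mod p) (c div l) else 0))"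
      using rc by (simp add: A_def G_def scalar_prod_def lessThan_atLeast0)
    also have "\<dots> = (\<Sum>j<l. \<Sum>b<p. C (r div p) j (r mod p) b
        * (if j = c mod l then g j b (c div l) else 0))"
      by (rule sum_lp)
    also have "\<dots> = (\<Sum>j<l. if j = c mod l then
        \<Sum>b<p. C (r div p) j (r mod p) b * g j b (c div l) else 0)"
      by (intro sum.cong) auto
    also have "\<dots> = (\<Sum>b<p. C (r div p) (c mod l) (r mod p) b * g (c mod l) b (c div l))"
      using bounds[OF rc(2)] by simp
    also have "\<dots> = g (r div p) (r mod p) (c div l) * d (c div l) (r div p) (c mod l)"
      using bounds[OF rc(1)] bounds[OF rc(2)] by (intro eig)
    \<comment> \<open>The single term is spread out again over Kronecker deltas in \<open>k\<close>
      and \<open>j\<close>, so that it can be read as an entry of the product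
      \<open>G * M\<close>.\<close>
    also have "\<dots> = (\<Sum>k<p. \<Sum>j<l. if r div p = j then
        if k = c div l then g (r div p) (r mod p) k * d k j (c mod l) else 0 else 0)"
      by (simp only: sum.delta sum.delta' finite_lessThan lessThan_iff
          bounds[OF rc(1)] bounds[OF rc(2)] if_True)
    also have "\<dots> = (\<Sum>k<p. \<Sum>j<l. (if r div p = j then g (r div p) (r mod p) k else 0)
        * (if k = c div l then d k j (c mod l) else 0))"
      by (intro sum.cong) auto
    also have "\<dots> = (\<Sum>e<N. (if r div p = e mod l then g (r div p) (r mod p) (e div l) else 0)
        * (if e div l = c div l then d (e div l) (e mod l) (c mod l) else 0))"
      by (rule sum_pl [symmetric])
    also have "\<dots> = (G * M) $$ (r, c)"
      using rc by (simp add: G_def M_def scalar_prod_def lessThan_atLeast0)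
    finally show "(A * G) $$ (r, c) = (G * M) $$ (r, c)" .
  qed (use carr in auto)
  moreover have GH: "G * H = 1\<^sub>m N"
  proof (rule eq_matI)
    fix r s assume "r < dim_row (1\<^sub>m N)" "s < dim_col (1\<^sub>m N)"
    then have rs: "r < N" "s < N"
      by auto
    have "(G * H) $$ (r, s) = (\<Sum>c<N. (if r div p = c mod l then g (r div p) (r mod p) (c div l) else 0)
        * (if s div p = c mod l then h (s div p) (c div l) (s mod p) else 0))"
      using rs by (simp add: G_def H_def scalar_prod_def lessThan_atLeast0)
    also have "\<dots> = (\<Sum>k<p. \<Sum>j<l. (if r div p = j then g (r div p) (r mod p) k else 0)
        * (if s div p = j then h (s div p) k (s mod p) else 0))"
      by (rule sum_pl)
    also have "\<dots> = (\<Sum>k<p. \<Sum>j<l. if r div p = j then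
        if s div p = r div p then g (r div p) (r mod p) k * h (r div p) k (s mod p) else 0 else 0)"
      by (intro sum.cong) auto
    also have "\<dots> = (if s div p = r div p
        then \<Sum>k<p. g (r div p) (r mod p) k * h (r div p) k (s mod p) else 0)"
      using bounds[OF rs(1)] by simp
    also have "\<dots> = (if s div p = r div p \<and> r mod p = s mod p then 1 else 0)"
      using bounds[OF rs(1)] bounds[OF rs(2)] by (simp add: inv)
    also have "\<dots> = 1\<^sub>m N $$ (r, s)"
      using rs by (auto, metis div_mult_mod_eq)
    finally show "(G * H) $$ (r, s) = 1\<^sub>m N $$ (r, s)" .
  qed (use carr in auto)
  moreover have "H * G = 1\<^sub>m N"
    by (rule mat_mult_left_right_inverse [OF carr(2,3) GH])
  moreover have "A = G * M * H"
  proof -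
    have "A = A * (G * H)"
      using carr by (simp add: GH)
    also have "\<dots> = A * G * H"
      by (rule assoc_mult_mat [OF carr(1-3), symmetric])
    finally show ?thesis
      by (simp only: \<open>A * G = G * M\<close>)
  qed
  ultimately have "similar_mat A M"
    using carr unfolding similar_mat_def similar_mat_wit_def
    by (intro exI[of _ G] exI[of _ H]) (auto simp: Let_def)
  then have "char_poly A = char_poly M"
    by (rule char_poly_similar)
  then show ?thesis
    using char_poly_block_diag[OF l, of p d] by (simp add: A_def M_def N_def mult.commute)
qed

section \<open>Circulant matrices and roots of unity\<close>

text \<open>Substituting \<open>b = (a + c) mod p\<close> turns row \<open>a\<close> into row 0,
  since both positions have index difference \<open>c\<close> modulo \<open>p\<close>. The power of
  \<open>w\<close> splits as \<open>w ^ a * w ^ c\<close> because exponents of \<open>w\<close>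
  count only modulo \<open>p\<close>.\<close>

lemma cyclic_mat_eigen:
  fixes A :: "'a :: comm_semiring_1 mat"
  assumes A: "cyclic_mat p A" and w: "w ^ p = 1" and a: "a < p"
  shows "(\<Sum>b<p. A $$ (a, b) * w ^ b) = w ^ a * (\<Sum>b<p. A $$ (0, b) * w ^ b)"
proof -
  have wmod: "w ^ (m mod p) = w ^ m" for m
  proof -
    have "w ^ m = w ^ (p * (m div p) + m mod p)"
      by simp
    then show ?thesis
      by (simp only: power_add power_mult w) simp
  qed
  have bij: "bij_betw (\<lambda>c. (a + c) mod p) {..<p} {..<p}"
  proof -
    have "inj_on (\<lambda>c. (a + c) mod p) {..<p}"
    proof (rule inj_onI)
      fix x y assume "x \<in> {..<p}" "y \<in> {..<p}" "(a + x) mod p = (a + y) mod p"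
      then show "x = y"
        using a by (auto simp: mod_if split: if_splits)
    qed
    moreover have "(\<lambda>c. (a + c) mod p) ` {..<p} \<subseteq> {..<p}"
      using a by auto
    ultimately show ?thesis
      by (simp add: bij_betw_def endo_inj_surj)
  qed
  have "(\<Sum>b<p. A $$ (a, b) * w ^ b) = (\<Sum>c<p. A $$ (a, (a + c) mod p) * w ^ ((a + c) mod p))"
    by (rule sum.reindex_bij_betw [OF bij, symmetric])
  also have "\<dots> = (\<Sum>c<p. w ^ a * (A $$ (0, c) * w ^ c))"
  proof (rule sum.cong [OF refl])
    fix c assume "c \<in> {..<p}"
    have "(int ((a + c) mod p) - int a) mod int p = (int c - int 0) mod int p"
      by (simp add: zmod_int mod_diff_left_eq)
    then have "A $$ (a, (a + c) mod p) = A $$ (0, c)"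
      using A a \<open>c \<in> {..<p}\<close> unfolding cyclic_mat_def by auto
    then show "A $$ (a, (a + c) mod p) * w ^ ((a + c) mod p) = w ^ a * (A $$ (0, c) * w ^ c)"
      by (simp add: wmod power_add ac_simps)
  qed
  also have "\<dots> = w ^ a * (\<Sum>b<p. A $$ (0, b) * w ^ b)"
    by (simp add: sum_distrib_left)
  finally show ?thesis .
qed

text \<open>This is a geometric sum with ratio \<open>v\<close>, which is \<open>w\<close> to the
  power a - b. As \<open>v ^ q = 1\<close>, it vanishes unless \<open>v = 1\<close>, and primitivity
  allows that only for \<open>a = b\<close>.\<close>

lemma primitive_root_orthogonality:
  assumes w: "primitive_root_of_unity q w" and a: "a < q" and b: "b < q"
  shows "(\<Sum>k<q. w ^ (a * k) * inverse w ^ (k * b)) = (if a = b then of_nat q else 0)"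
proof -
  have q: "q > 0" "w ^ q = 1" and prim: "\<And>m. 0 < m \<Longrightarrow> m < q \<Longrightarrow> w ^ m \<noteq> 1"
    using w by (auto simp: primitive_root_of_unity_def)
  have w0: "w \<noteq> 0"
    using q by (metis power_0_left zero_neq_one not_gr_zero)
  define v where "v = w ^ a * inverse w ^ b"
  have v: "w ^ (a * k) * inverse w ^ (k * b) = v ^ k" for k
    by (simp add: v_def power_mult_distrib power_mult [symmetric] mult.commute)
  have vq: "v ^ q = 1"
  proof -
    have "v ^ q = (w ^ q) ^ a * inverse (w ^ q) ^ b"
      by (simp add: v_def power_mult_distrib power_inverse mult.commute flip: power_mult)
    then show ?thesis
      by (simp add: q)
  qed
  have v1: "v = 1 \<longleftrightarrow> a = b"
  proof
    assume "v = 1"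
    then have eq: "w ^ a = w ^ b"
      using w0 by (simp add: v_def field_simps)
    have "False" if "x < y" "y < q" "w ^ x = w ^ y" for x y
    proof -
      have "w ^ x * w ^ (y - x) = w ^ y"
        using \<open>x < y\<close> by (simp flip: power_add)
      then show False
        using prim[of "y - x"] that w0 by simp
    qed
    then show "a = b"
      using eq a b by (metis linorder_neqE_nat)
  qed (use w0 in \<open>simp add: v_def field_simps\<close>)
  have sum_v: "(\<Sum>k<q. w ^ (a * k) * inverse w ^ (k * b)) = (\<Sum>k<q. v ^ k)"
    by (simp only: v)
  show ?thesis
  proof (cases "a = b")
    case True
    then show ?thesis
      unfolding sum_v using v1 by simp
  next
    case False
    then have "v \<noteq> 1"
      using v1 by simp
    then have "(\<Sum>k<q. v ^ k) = 0"
      using vq by (simp add: sum_gp_strict)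
    then show ?thesis
      unfolding sum_v using False by simp
  qed
qed

section \<open>The padded matrix and its block diagonalisation\<close>

text \<open>The factor \<open>[:0, 1:] ^ n\<close> comes from the zero padding; keeping it on the
  left avoids division and leaves an identity of polynomials. The last block has index
  \<open>m\<close>.\<close>

lemma char_poly_assemble:
  fixes m n :: nat
    and \<zeta> :: "nat \<Rightarrow> complex"
    and B :: "nat \<Rightarrow> nat \<Rightarrow> complex mat"
    and X Y :: "nat \<Rightarrow> complex mat"
  assumes n: "n > 0"
    and prim2: "primitive_root_of_unity (2 * n) (\<zeta> (2 * n))"
    and prim: "primitive_root_of_unity n (\<zeta> n)"
    and \<zeta>_eq: "\<zeta> n = \<zeta> (2 * n) ^ 2"
    and B: "\<And>i j. i < m \<Longrightarrow> j < m \<Longrightarrow> cyclic_mat (2 * n) (B i j)"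
    and W: "cyclic_mat n (B m m)"
    and X: "\<And>i. i < m \<Longrightarrow> cyclic_mat n (X i)"
    and BX: "\<And>i. i < m \<Longrightarrow> B i m = X i @\<^sub>r X i"
    and Y: "\<And>j. j < m \<Longrightarrow> cyclic_mat n (Y j)"
    and BY: "\<And>j. j < m \<Longrightarrow> B m j = append_cols (Y j) (Y j)"
  shows "[:0, 1:] ^ n * char_poly (assemble (Suc m) n B) = (\<Prod>k<2 * n. char_poly (D_bar \<zeta> (Suc m) n B k))"
proof -
  define \<omega> where "\<omega> = \<zeta> (2 * n)"
  \<comment> \<open>The blocks, extended by zero so that all of them have size
    \<open>2 * n\<close>.\<close>
  define C where "C i j a b =
    (if i = m \<and> n \<le> a \<or> j = m \<and> n \<le> b then 0 else B i j $$ (a, b))" for i j a b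
  \<comment> \<open>In the last block the first \<open>n\<close> positions carry the vectors for
    even \<open>k\<close>, while the padding position \<open>n + q\<close> is assigned to the odd
    value \<open>k = 2 * q + 1\<close>.\<close>
  define g where "g i a k =
    (if i < m then \<omega> ^ (a * k)
     else if a < n then if even k then \<omega> ^ (a * k) else 0
     else if k = Suc (2 * (a - n)) then 1 else 0)" for i a k
  \<comment> \<open>The inverse transform of \<open>g\<close>: the divisors \<open>2 * n\<close> and
    \<open>n\<close> are the values of the orthogonality sums on the diagonal.\<close>
  define h where "h i k b =
    (if i < m then inverse \<omega> ^ (k * b) / of_nat (2 * n)
     else if b < n then if even k then inverse \<omega> ^ (k * b) / of_nat n else 0
     else if k = Suc (2 * (b - n)) then 1 else 0)" for i k b
  define d where "d k i j = D_bar \<zeta> (Suc m) n B k $$ (i, j)" for k i j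
  have \<omega>2n: "\<omega> ^ (2 * n) = 1" and "\<omega> ^ n \<noteq> 1"
    using prim2 n by (auto simp: primitive_root_of_unity_def \<omega>_def)
  \<comment> \<open>A square root of 1 other than 1; primitivity was used at the exponent
    \<open>n < 2 * n\<close>.\<close>
  then have \<omega>n: "\<omega> ^ n = - 1"
    by (metis mult.commute power2_eq_1_iff power_mult)
  have \<omega>nk: "\<omega> ^ (n * k) = (if even k then 1 else - 1)" for k
    by (simp add: power_mult \<omega>n)

  have X_carr: "X i \<in> carrier_mat n n" if "i < m" for i
    using X[OF that] by (simp add: cyclic_mat_def)
  have Y_carr: "Y i \<in> carrier_mat n n" if "i < m" for i
    using Y[OF that] by (simp add: cyclic_mat_def)
  have mod_n: "a mod n = (if a < n then a else a - n)" if "a < 2 * n" for a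
    using that by (simp add: mod_if)
  have BX_entry: "B i m $$ (a, b) = X i $$ (a mod n, b)" if "i < m" "a < 2 * n" "b < n" for i a b
    using X_carr[OF that(1)] that by (auto simp: BX append_rows_def mod_n)
  have BY_entry: "B m j $$ (a, b) = Y j $$ (a, b mod n)" if "j < m" "a < n" "b < 2 * n" for j a b
    using Y_carr[OF that(1)] that by (auto simp: BY append_cols_def mod_n)
  have B_dim: "dim_row (B i j) = (if i = m then n else 2 * n)"
    "dim_col (B i j) = (if j = m then n else 2 * n)" if ij: "i < Suc m" "j < Suc m" for i j
  proof -
    consider "i < m" "j < m" | "i < m" "j = m" | "i = m" "j < m"
      | "i = m" "j = m"
      using ij by linarith
    then have "dim_row (B i j) = (if i = m then n else 2 * n) \<and>
        dim_col (B i j) = (if j = m then n else 2 * n)"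
    proof cases
      case 1
      then show ?thesis using B[of i j] by (auto simp: cyclic_mat_def)
    next
      case 2
      then show ?thesis using X_carr[of i] by (auto simp: BX append_rows_def)
    next
      case 3
      then show ?thesis using Y_carr[of j] by (auto simp: BY append_cols_def)
    next
      case 4
      then show ?thesis using W by (auto simp: cyclic_mat_def)
    qed
    then show "dim_row (B i j) = (if i = m then n else 2 * n)"
      "dim_col (B i j) = (if j = m then n else 2 * n)"
      by auto
  qed
  have d_left: "d k i j = (\<Sum>b<2 * n. B i j $$ (0, b) * \<omega> ^ (b * k))" if "i < Suc m" "j < m" for k i j
    using that n B_dim[of i j]
    by (auto simp: d_def D_bar_def scalar_prod_def z_vec_def \<omega>_def lessThan_atLeast0)
  have d_last: "d k i m = (if even k then \<Sum>b<n. B i m $$ (0, b) * \<omega> ^ (b * k) else 0)"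
    if "i < Suc m" for k i
  proof -
    have "\<zeta> n ^ (b * (k div 2)) = \<omega> ^ (b * k)" if "even k" for b
      using that by (auto simp: \<zeta>_eq \<omega>_def simp flip: power_mult elim!: evenE intro!: arg_cong[of _ _ "power _"])
    then show ?thesis
      using that n B_dim[of i "m"]
      by (auto simp: d_def D_bar_def scalar_prod_def z_vec_def lessThan_atLeast0)
  qed
  \<comment> \<open>The condition on \<open>q\<close> holds for every \<open>k\<close> if
    \<open>q = 2 * n\<close>, but for \<open>q = n\<close> only if \<open>k\<close> is even.\<close>
  have cyc: "(\<Sum>b<q. A $$ (a, b) * \<omega> ^ (b * k)) = \<omega> ^ (a * k) * (\<Sum>b<q. A $$ (0, b) * \<omega> ^ (b * k))"
    if "cyclic_mat q A" "\<omega> ^ (q * k) = 1" "a < q" for A q a k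
    using cyclic_mat_eigen[OF that(1) _ that(3), of "\<omega> ^ k"] that(2)
    by (simp add: mult.commute flip: power_mult)
  have trunc: "(\<Sum>b<2 * n. if n \<le> b then 0 else f b) = (\<Sum>b<n. f b)" for f :: "nat \<Rightarrow> complex"
    by (simp add: sum_double)

  have eig: "(\<Sum>b<2 * n. C i j a b * g j b k) = g i a k * d k i j"
    if i: "i < Suc m" and j: "j < Suc m" and a: "a < 2 * n" for i j a k
  proof -
    have to_n: "(\<Sum>b<2 * n. C i m a b * g m b k)
        = (if even k then \<Sum>b<n. B i m $$ (a, b) * \<omega> ^ (b * k) else 0)"
      if "i < m \<or> a < n"
    proof -
      have "(\<Sum>b<2 * n. C i m a b * g m b k)
        = (\<Sum>b<2 * n. if n \<le> b then 0 else if even k then B i m $$ (a, b) * \<omega> ^ (b * k) else 0)"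
        using that by (intro sum.cong) (auto simp: C_def g_def)
      then show ?thesis
        by (simp add: trunc)
    qed
    \<comment> \<open>Cases (a) to (d) are the four kinds of blocks of the original matrix; (e) is a
      padding row.\<close>
    consider (a) "i < m" "j < m" | (b) "i < m" "j = m" | (c) "i = m" "a < n" "j < m"
      | (d) "i = m" "a < n" "j = m" | (e) "i = m" "n \<le> a"
      using i j by linarith
    then show ?thesis
    proof cases
      case a
      have "(\<Sum>b<2 * n. C i j a b * g j b k) = (\<Sum>b<2 * n. B i j $$ (a, b) * \<omega> ^ (b * k))"
        using a by (simp add: C_def g_def)
      also have "\<dots> = \<omega> ^ (a * k) * (\<Sum>b<2 * n. B i j $$ (0, b) * \<omega> ^ (b * k))"
        using \<open>a < 2 * n\<close> \<omega>2n by (intro cyc B a) (simp_all add: power_mult)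
      also have "\<dots> = g i a k * d k i j"
        using a i by (simp add: d_left g_def)
      finally show ?thesis .
    next
      case b
      have "(\<Sum>b<n. B i m $$ (a, b) * \<omega> ^ (b * k))
          = \<omega> ^ (a * k) * (\<Sum>b<n. B i m $$ (0, b) * \<omega> ^ (b * k))" if k: "even k"
      proof -
        have "(\<Sum>b<n. B i m $$ (a, b) * \<omega> ^ (b * k)) = (\<Sum>b<n. X i $$ (a mod n, b) * \<omega> ^ (b * k))"
          using b a by (simp add: BX_entry)
        also have "\<dots> = \<omega> ^ (a mod n * k) * (\<Sum>b<n. X i $$ (0, b) * \<omega> ^ (b * k))"
          using n k by (intro cyc X b) (simp_all add: \<omega>nk)
        \<comment> \<open>For even \<open>k\<close> the powers of \<open>\<omega> ^ k\<close> have
          period \<open>n\<close>, which matches the two stacked copies of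
          \<open>X i\<close>.\<close>
        also have "\<omega> ^ (a mod n * k) = \<omega> ^ (a * k)"
        proof -
          have "\<omega> ^ (a * k) = \<omega> ^ (n * (a div n * k) + a mod n * k)"
            by (metis add_mult_distrib mult.assoc mult_div_mod_eq)
          then show ?thesis
            using k by (simp add: power_add \<omega>nk)
        qed
        also have "(\<Sum>b<n. X i $$ (0, b) * \<omega> ^ (b * k)) = (\<Sum>b<n. B i m $$ (0, b) * \<omega> ^ (b * k))"
          using b n by (simp add: BX_entry)
        finally show ?thesis .
      qed
      then show ?thesis
        unfolding b(2) d_last[OF i] using b by (subst to_n) (auto simp: g_def)
    next
      case c
      \<comment> \<open>Shifting \<open>b\<close> by \<open>n\<close> multiplies the power by
        \<open>\<omega> ^ (n * k)\<close>, so the two copies of \<open>Y j\<close> add up for even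
        \<open>k\<close> and cancel for odd \<open>k\<close>.\<close>
      have Ysum: "(\<Sum>b<2 * n. B m j $$ (a, b) * \<omega> ^ (b * k))
          = (if even k then 2 * (\<Sum>b<n. Y j $$ (a, b) * \<omega> ^ (b * k)) else 0)" if "a < n" for a
        using that c
        by (auto simp: sum_double BY_entry add_mult_distrib power_add \<omega>nk sum_negf)
      have "(\<Sum>b<2 * n. C i j a b * g j b k) = (\<Sum>b<2 * n. B m j $$ (a, b) * \<omega> ^ (b * k))"
        using c by (simp add: C_def g_def)
      also have "\<dots> = (if even k then \<omega> ^ (a * k) * (2 * (\<Sum>b<n. Y j $$ (0, b) * \<omega> ^ (b * k))) else 0)"
        using c cyc[OF Y, of j k a] by (simp add: Ysum \<omega>nk)
      also have "\<dots> = g i a k * d k i j"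
        using c i n by (simp add: d_left g_def Ysum)
      finally show ?thesis .
    next
      case d
      have "(\<Sum>b<n. B m m $$ (a, b) * \<omega> ^ (b * k))
          = \<omega> ^ (a * k) * (\<Sum>b<n. B m m $$ (0, b) * \<omega> ^ (b * k))" if "even k"
        using d that by (intro cyc W) (simp_all add: \<omega>nk)
      then show ?thesis
        unfolding d(3) d_last[OF i] using d by (subst to_n) (auto simp: g_def)
    next
      case e
      \<comment> \<open>A padding row of \<open>C\<close> is zero, and \<open>g m a k\<close> is
        nonzero there only for one odd \<open>k\<close>. So the last row of \<open>D_bar\<close>
        must vanish for odd \<open>k\<close>: by definition in the last column, by the cancellation
        of the two copies of \<open>Y j\<close> elsewhere.\<close>
      have "d k m j = 0" if "odd k"
      proof (cases "j = m")
        case True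
        then show ?thesis using that by (simp add: d_last)
      next
        case False
        then have "j < m" using j by simp
        then show ?thesis
          using that n by (simp add: d_left sum_double BY_entry add_mult_distrib power_add \<omega>nk sum_negf)
      qed
      then show ?thesis
        using e by (auto simp: C_def g_def)
    qed
  qed

  have inv: "(\<Sum>k<2 * n. g i a k * h i k b) = (if a = b then 1 else 0)"
    if "a < 2 * n" "b < 2 * n" for i a b
  proof (cases "i < m")
    case True
    then have "(\<Sum>k<2 * n. g i a k * h i k b)
        = (\<Sum>k<2 * n. \<omega> ^ (a * k) * inverse \<omega> ^ (k * b)) / of_nat (2 * n)"
      by (simp add: g_def h_def sum_divide_distrib)
    then show ?thesis
      using primitive_root_orthogonality[OF prim2 that] n by (simp add: \<omega>_def)
  next
    case False
    have pow: "\<omega> ^ (a * (2 * q)) * inverse \<omega> ^ (2 * q * b) = \<zeta> n ^ (a * q) * inverse (\<zeta> n) ^ (q * b)" for q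
      by (simp add: \<zeta>_eq \<omega>_def power_inverse ac_simps flip: power_mult)
    have parity: "2 * x \<noteq> Suc (2 * y)" for x y :: nat
      by presburger
    \<comment> \<open>Even \<open>k\<close> pair only positions below \<open>n\<close>, by a Fourier
      sum of length \<open>n\<close>; odd \<open>k\<close> pair only padding positions.\<close>
    have "(\<Sum>q<n. g i a (2 * q) * h i (2 * q) b)
        = (if a < n \<and> b < n then (\<Sum>q<n. \<zeta> n ^ (a * q) * inverse (\<zeta> n) ^ (q * b)) / of_nat n else 0)"
      using False by (auto simp: g_def h_def parity sum_divide_distrib simp flip: pow)
    moreover have "(\<Sum>q<n. g i a (Suc (2 * q)) * h i (Suc (2 * q)) b)
        = (\<Sum>q<n. if q = a - n then if n \<le> a \<and> n \<le> b \<and> a - n = b - n then 1 else 0 else 0)"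
      using False by (intro sum.cong) (auto simp: g_def h_def)
    ultimately have "(\<Sum>k<2 * n. g i a k * h i k b)
        = (if a < n \<and> b < n then (\<Sum>q<n. \<zeta> n ^ (a * q) * inverse (\<zeta> n) ^ (q * b)) / of_nat n else 0)
          + (if n \<le> a \<and> n \<le> b \<and> a - n = b - n then 1 else 0)"
      using that by (simp add: sum_even_odd less_diff_conv2)
    then show ?thesis
      using primitive_root_orthogonality[OF prim, of a b] n that by auto
  qed

  define N where "N = m * (2 * n) + n"
  have N: "Suc m * (2 * n) = N + n"
    by (simp add: N_def)
  \<comment> \<open>The padding is the second half of the last block, hence exactly the final
    \<open>n\<close> indices. This makes the matrix built from \<open>C\<close> a four-block matrix
    with \<open>assemble\<close> in its upper left corner.\<close>
  have div_mod: "r div (2 * n) = m \<and> n \<le> r mod (2 * n) \<longleftrightarrow> \<not> r < N" if "r < N + n" for r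
  proof -
    have "r div (2 * n) \<le> m"
      using that less_mult_imp_div_less[of r "Suc m" "2 * n"] unfolding N by linarith
    show ?thesis
    proof (cases "r div (2 * n) = m")
      case True
      then show ?thesis
        using div_mult_mod_eq[of r "2 * n"] by (auto simp: N_def)
    next
      case False
      then have "Suc (r div (2 * n)) * (2 * n) \<le> m * (2 * n)"
        using \<open>r div (2 * n) \<le> m\<close> by (intro mult_le_mono1) simp
      then have "r < m * (2 * n)"
        using n dividend_less_div_times[of "2 * n" r] by simp
      then show ?thesis
        using False by (simp add: N_def)
    qed
  qed
  have pad: "four_block_mat (assemble (Suc m) n B) (0\<^sub>m N n) (0\<^sub>m n N) (0\<^sub>m n n)
      = mat (N + n) (N + n)
          (\<lambda>(r, s). C (r div (2 * n)) (s div (2 * n)) (r mod (2 * n)) (s mod (2 * n)))"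
  proof (rule eq_matI, goal_cases)
    case (1 r s)
    then show ?case
      using div_mod[of r] div_mod[of s] by (auto simp: C_def assemble_def simp flip: N_def)
  qed (simp_all add: assemble_def flip: N_def)
  have "assemble (Suc m) n B \<in> carrier_mat N N"
    by (simp add: assemble_def N_def)
  then have "char_poly (assemble (Suc m) n B) * char_poly (0\<^sub>m n n)
      = char_poly (four_block_mat (assemble (Suc m) n B) (0\<^sub>m N n) (0\<^sub>m n N) (0\<^sub>m n n))"
    by (simp add: char_poly_four_block_mat_diag)
  also have "\<dots> = (\<Prod>k<2 * n. char_poly (mat (Suc m) (Suc m) (\<lambda>(i, j). d k i j)))"
    unfolding pad N [symmetric]
    using n by (intro char_poly_block_diagonalised [where g = g and h = h] eig inv) simp_all
  also have "\<dots> = (\<Prod>k<2 * n. char_poly (D_bar \<zeta> (Suc m) n B k))"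
    by (intro prod.cong arg_cong [of _ _ char_poly] refl eq_matI) (simp_all add: d_def D_bar_def)
  finally show ?thesis
    by (simp add: char_poly_zero_mat mult.commute)
qed

section \<open>Passage to the field of rational functions\<close>

lemma to_fract_prod: "to_fract (prod f A) = (\<Prod>x\<in>A. to_fract (f x))"
  by (induction A rule: infinite_finite_induct) simp_all

lemma to_fract_power: "to_fract (x ^ n) = to_fract x ^ n"
  by (induction n) simp_all

theorem theorem2p9:
  fixes l n :: nat
    and \<zeta> :: "nat \<Rightarrow> complex"
    and B :: "nat \<Rightarrow> nat \<Rightarrow> complex mat"
    and X Y :: "nat \<Rightarrow> complex mat"
  defines "D \<equiv> assemble l n B"
    and "t \<equiv> to_fract [:0, 1 :: complex:]"
    and "\<chi> \<equiv> \<lambda>A :: complex mat. to_fract (char_poly A)"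
  assumes "l > 0" and "n > 0"
    and "primitive_root_of_unity (2 * n) (\<zeta> (2 * n))"
    and "primitive_root_of_unity n (\<zeta> n)"
    and "\<zeta> n = \<zeta> (2 * n) ^ 2"
    and "\<And>i j. i < l - 1 \<Longrightarrow> j < l - 1 \<Longrightarrow> cyclic_mat (2 * n) (B i j)"
    and "cyclic_mat n (B (l - 1) (l - 1))"
    and "\<And>i. i < l - 1 \<Longrightarrow> cyclic_mat n (X i)"
    and "\<And>i. i < l - 1 \<Longrightarrow> B i (l - 1) = X i @\<^sub>r X i"
    and "\<And>j. j < l - 1 \<Longrightarrow> cyclic_mat n (Y j)"
    and "\<And>j. j < l - 1 \<Longrightarrow> B (l - 1) j = append_cols (Y j) (Y j)"
  shows "\<chi> D = (\<Prod>k | k \<le> 2 * n - 1 \<and> even k. \<chi> (D_bar \<zeta> l n B k))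
               * (\<Prod>k | k \<le> 2 * n - 1 \<and> odd k. 1 / t * \<chi> (D_bar \<zeta> l n B k))
       \<and> (\<Prod>k | k \<le> 2 * n - 1 \<and> even k. \<chi> (D_bar \<zeta> l n B k))
               * (\<Prod>k | k \<le> 2 * n - 1 \<and> odd k. 1 / t * \<chi> (D_bar \<zeta> l n B k))
         = 1 / t ^ n * (\<Prod>k = 0..2 * n - 1. \<chi> (D_bar \<zeta> l n B k))"
proof -
  have t: "t \<noteq> 0"
    by (simp add: t_def)
  have lt: "k \<le> 2 * n - 1 \<longleftrightarrow> k < 2 * n" for k
    using \<open>n > 0\<close> by auto
  have "t ^ n * \<chi> D = (\<Prod>k<2 * n. \<chi> (D_bar \<zeta> l n B k))"
  proof -
    obtain m where m: "l = Suc m"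
      using \<open>l > 0\<close> by (cases l) auto
    have "[:0, 1:] ^ n * char_poly D = (\<Prod>k<2 * n. char_poly (D_bar \<zeta> l n B k))"
      unfolding D_def m
      by (rule char_poly_assemble[where X = X and Y = Y]) (use assms m in simp_all)
    \<comment> \<open>The polynomial identity is moved to the fraction field, where dividing by
      \<open>t ^ n\<close> makes sense.\<close>
    from arg_cong[OF this, of to_fract] show ?thesis
      by (simp add: t_def \<chi>_def to_fract_prod to_fract_power)
  qed
  then have D: "\<chi> D = 1 / t ^ n * (\<Prod>k<2 * n. \<chi> (D_bar \<zeta> l n B k))"
    using t by (simp add: field_simps)
  have range: "{0..2 * n - 1} = {..<2 * n}"
    using \<open>n > 0\<close> by auto
  \<comment> \<open>Counting the odd \<open>k\<close> shows that the factors \<open>1 / t\<close>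
    multiply to \<open>1 / t ^ n\<close>.\<close>
  have "{k. k < 2 * n \<and> odd k} = (\<lambda>m. Suc (2 * m)) ` {..<n}"
    by (auto elim!: oddE)
  then have card_odd: "card {k. k < 2 * n \<and> odd k} = n"
    by (simp add: card_image inj_on_def)
  have "(\<Prod>k<2 * n. \<chi> (D_bar \<zeta> l n B k))
      = (\<Prod>k | k < 2 * n \<and> even k. \<chi> (D_bar \<zeta> l n B k))
        * (\<Prod>k | k < 2 * n \<and> odd k. \<chi> (D_bar \<zeta> l n B k))"
    by (subst prod.union_disjoint [symmetric]) (auto intro!: prod.cong)
  moreover have "(\<Prod>k | k < 2 * n \<and> odd k. 1 / t * \<chi> (D_bar \<zeta> l n B k))
      = 1 / t ^ n * (\<Prod>k | k < 2 * n \<and> odd k. \<chi> (D_bar \<zeta> l n B k))"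
    by (simp add: prod_dividef card_odd)
  ultimately show ?thesis
    unfolding lt range D by (simp add: ac_simps)
qed

end
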